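(* Let $\mathbf{C}_1,\dots,\mathbf{C}_\kappa$ be real $r\times r$ matrices with $\mathbf{C}_k=\mathbf{Q}_0\mathbf{D}_k\mathbf{Q}_0^{-1}$ for all $k$, where $\mathbf{Q}_0$ is invertible and each $\mathbf{D}_k$ is diagonal. Let $\mathbf{C}=(\mathbf{C}_1,\dots,\mathbf{C}_\kappa)$, let $\widehat{\mathbf{C}}=(\widehat{\mathbf{C}}_1,\dots,\widehat{\mathbf{C}}_\kappa)$ be an estimator of $\mathbf{C}$ computed from a sample of size $n$, and let $\widehat{\mathbf{Q}}$ be a solution to $$\min_{\mathbf{Q}\in\mathscr{Q}}\sum_{k=1}^\kappa\bigl\Vert\operatorname{off}\bigl(\mathbf{Q}^{-1}\widehat{\mathbf{C}}_k\mathbf{Q}\bigr)\bigr\Vert_F^2,$$ with $\mathscr{Q}$, $\mathbf{Q}_0$ and the standing conventions as in the context. Let $\widehat{\mathbf{D}}_k=\operatorname{diag}(\widehat{\mathbf{Q}}^{-1}\widehat{\mathbf{C}}_k\widehat{\mathbf{Q}})$, $\widehat{\mathbf{D}}=(\widehat{\mathbf{D}}_1,\dots,\widehat{\mathbf{D}}_\kappa)$, $\mathbf{D}=(\mathbf{D}_1,\dots,\mathbf{D}_\kappa)$, and $$\mathbf{H}=(\mathbf{I}_\kappa\otimes\mathbf{S}_r)\bigl(\mathbf{I}_\kappa\otimes\mathbf{Q}_0^\prime\otimes\mathbf{Q}_0^{-1}\bigr),\qquad \mathbf{S}_r=\operatorname{diag}(\operatorname{vec}\mathbf{I}_r).$$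 If $\Vert\widehat{\mathbf{C}}-\mathbf{C}\Vert_F=O_p(n^{-1/2})$, then $$\sqrt{n}\,\operatorname{vec}(\widehat{\mathbf{D}}-\mathbf{D})=\mathbf{H}\,\sqrt{n}\,\operatorname{vec}(\widehat{\mathbf{C}}-\mathbf{C})+o_p(1)$$ as $n\to\infty$.
   Context: $r$ and $\kappa$ are fixed. In this statement $\otimes$ is the Kronecker product, $\operatorname{vec}$ stacks columns, $\mathbf{I}_r$ is the $r\times r$ identity, $\Vert\cdot\Vert_F$ is the Frobenius norm. For a square matrix $\mathbf{Q}$, $\operatorname{diag}\mathbf{Q}$ is the diagonal matrix with the same diagonal as $\mathbf{Q}$, and $\operatorname{off}\mathbf{Q}=\mathbf{Q}-\operatorname{diag}\mathbf{Q}$; for a vector, $\operatorname{diag}$ is the diagonal matrix with that vector on its diagonal. Thus $\mathbf{S}_r$ is the $r^2\times r^2$ selection matrix with $\mathbf{S}_r\operatorname{vec}\mathbf{Q}=\operatorname{vec}(\operatorname{diag}\mathbf{Q})$. For a constant $m\in(0,\infty)$, $\mathscr{Q}$ is the set of real $r\times r$ matrices $\mathbf{Q}=(\mathbf{q}_1,\dots,\mathbf{q}_r)$ with $\det\mathbf{Q}=1$ and $\Vert\mathbf{q}_j\Vert_F=c$ for all $j$, for some $c\le m$ (the same $c$ for all columns). $m$ is large enough that $\mathscr{Q}$ contains a joint diagonalizer of $\mathbf{C}_1,\dots,\mathbf{C}_\kappa$. Let $\mathbf{Q}_*$ be any minimizer of $\sum_k\Vert\operatorname{off}(\mathbf{Q}^{-1}\mathbf{C}_k\mathbf{Q})\Vert_F^2$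 over $\mathscr{Q}$, and let $\mathscr{Q}_0$ be the set of all $\mathbf{Q}_*\boldsymbol{\Delta}\boldsymbol{\Theta}$ with $\boldsymbol{\Delta}$ a permutation matrix and $\boldsymbol{\Theta}$ diagonal with entries in $\{1,-1\}$ such that $\det(\boldsymbol{\Delta}\boldsymbol{\Theta})=1$. Standing assumptions: $\mathscr{Q}_0$ is exactly the set of minimizers on $\mathscr{Q}$ (equivalently, the vectors $((\mathbf{D}_1)_{jj},\dots,(\mathbf{D}_\kappa)_{jj})$, $j=1,\dots,r$, are pairwise distinct); $\mathscr{Q}_0$ lies in the interior of $\mathscr{Q}$ relative to the set of matrices with determinant one and equal column norms (i.e. $c<m$). Convention on $\mathbf{Q}_0$: $\mathbf{Q}_0=\mathbf{Q}_*\boldsymbol{\Delta}_0\boldsymbol{\Theta}_0\in\mathscr{Q}_0$ is the element of $\mathscr{Q}_0$ to which $\widehat{\mathbf{Q}}$ converges in probability (permutation and signs being fixed so that $\widehat{\mathbf{Q}}\to_p\mathbf{Q}_0$), and $\mathbf{D}_k=\mathbf{Q}_0^{-1}\mathbf{C}_k\mathbf{Q}_0$. *)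

theory Defs
  imports "HOL-Probability.Probability"
begin

section \<open>Matrix operations\<close>

text \<open>
  A \<kappa>-tuple of matrices is an element of \<^typ>\<open>real^'r^'r^'k\<close>, with \<^term>\<open>C $ k\<close> the \<open>k\<close>-th matrix.
  The library's \<^const>\<open>norm\<close> on iterated vector types is the Euclidean norm of all entries, so it is
  the Frobenius norm both for matrices and for such tuples.
\<close>

lemma norm_matrix_eq_frobenius:
  fixes A :: "real^'n^'m"
  shows "norm A = sqrt (\<Sum>i\<in>UNIV. \<Sum>j\<in>UNIV. (A $ i $ j)\<^sup>2)"
  by (simp add: norm_vec_def L2_set_def sum_nonneg)

lemma norm_tuple_eq_frobenius:
  fixes C :: "real^'n^'m^'k"
  shows "norm C = sqrt (\<Sum>k\<in>UNIV. \<Sum>i\<in>UNIV. \<Sum>j\<in>UNIV. (C $ k $ i $ j)\<^sup>2)"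
  by (simp add: norm_vec_def L2_set_def sum_nonneg)

definition diagonal_matrix :: "real^'r^'r \<Rightarrow> bool" where
  "diagonal_matrix A \<longleftrightarrow> (\<forall>i j. i \<noteq> j \<longrightarrow> A $ i $ j = 0)"

definition diag_part :: "real^'r^'r \<Rightarrow> real^'r^'r" where
  "diag_part A = (\<chi> i j. if i = j then A $ i $ j else 0)"

definition off_part :: "real^'r^'r \<Rightarrow> real^'r^'r" where
  "off_part A = A - diag_part A"

definition diag_of_vec :: "real^'n \<Rightarrow> real^'n^'n" where
  "diag_of_vec v = (\<chi> i j. if i = j then v $ i else 0)"

text \<open>
  Column stacking: the entry in row \<open>i\<close> of column \<open>j\<close> sits at position \<open>(j, i)\<close>; pairs are thought
  of as ordered lexicographically. In the Kronecker product the first component of an index pair is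
  the block index.
\<close>

definition vec_cols :: "real^'n^'m \<Rightarrow> real^('n \<times> 'm)" where
  "vec_cols A = (\<chi> p. A $ snd p $ fst p)"

definition vec_tuple :: "real^'n^'m^'k \<Rightarrow> real^('k \<times> 'n \<times> 'm)" where
  "vec_tuple C = (\<chi> p. vec_cols (C $ fst p) $ snd p)"

definition kronecker :: "real^'n^'m \<Rightarrow> real^'q^'p \<Rightarrow> real^('n \<times> 'q)^('m \<times> 'p)"
    (infixr \<open>\<otimes>\<^sub>K\<close> 75) where
  "A \<otimes>\<^sub>K B = (\<chi> p q. A $ fst p $ fst q * B $ snd p $ snd q)"

definition selection_matrix :: "real^('r::finite \<times> 'r)^('r \<times> 'r)" where
  "selection_matrix = diag_of_vec (vec_cols (mat 1 :: real^'r^'r))"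

lemma selection_matrix_vec_cols:
  fixes A :: "real^'r^'r"
  shows "selection_matrix *v vec_cols A = vec_cols (diag_part A)"
proof -
  have "(diag_of_vec v *v w) $ p = v $ p * w $ p" for v w :: "real^('r \<times> 'r)" and p
    by (simp add: diag_of_vec_def matrix_vector_mult_def if_distrib[where f = "\<lambda>x. x * _"]
        cong: if_cong)
  then show ?thesis
    by (simp add: vec_eq_iff selection_matrix_def vec_cols_def diag_part_def mat_def)
qed

lemma kronecker_vec_cols:
  fixes A :: "real^'n^'m" and X :: "real^'p^'n" and B :: "real^'q^'p"
  shows "(transpose B \<otimes>\<^sub>K A) *v vec_cols X = vec_cols (A ** X ** B)"
proof -
  have "(\<Sum>q\<in>UNIV. B $ fst q $ j * A $ i $ snd q * X $ snd q $ fst q)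
      = (\<Sum>b\<in>UNIV. (\<Sum>a\<in>UNIV. A $ i $ a * X $ a $ b) * B $ b $ j)" for i j
  proof -
    have "(\<Sum>q\<in>UNIV. B $ fst q $ j * A $ i $ snd q * X $ snd q $ fst q)
        = (\<Sum>b\<in>UNIV. \<Sum>a\<in>UNIV. B $ b $ j * A $ i $ a * X $ a $ b)"
      by (simp add: sum.cartesian_product case_prod_unfold)
    also have "\<dots> = (\<Sum>b\<in>UNIV. (\<Sum>a\<in>UNIV. A $ i $ a * X $ a $ b) * B $ b $ j)"
      by (simp add: sum_distrib_left mult_ac)
    finally show ?thesis .
  qed
  then show ?thesis
    by (simp add: vec_eq_iff kronecker_def vec_cols_def matrix_vector_mult_def
        matrix_matrix_mult_def transpose_def)
qed


section \<open>Joint diagonalization\<close>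

definition off_criterion :: "real^'r^'r^'k \<Rightarrow> real^'r^'r \<Rightarrow> real" where
  "off_criterion C Q = (\<Sum>k\<in>UNIV. (norm (off_part (matrix_inv Q ** C $ k ** Q)))\<^sup>2)"

definition det_one_equal_norms :: "(real^'r^'r) set" where
  "det_one_equal_norms = {Q. det Q = 1 \<and> (\<exists>c. \<forall>j. norm (column j Q) = c)}"

definition feasible :: "real \<Rightarrow> (real^'r^'r) set" where
  "feasible m = {Q. det Q = 1 \<and> (\<exists>c\<le>m. \<forall>j. norm (column j Q) = c)}"

definition is_minimizer :: "real \<Rightarrow> real^'r^'r^'k \<Rightarrow> real^'r^'r \<Rightarrow> bool" where
  "is_minimizer m C Q \<longleftrightarrow> is_arg_min (off_criterion C) (\<lambda>Q. Q \<in> feasible m) Q"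

definition permutation_matrix :: "real^'r^'r \<Rightarrow> bool" where
  "permutation_matrix P \<longleftrightarrow> (\<exists>\<pi>. bij \<pi> \<and> P = (\<chi> i j. if i = \<pi> j then 1 else 0))"

definition sign_matrix :: "real^'r^'r \<Rightarrow> bool" where
  "sign_matrix T \<longleftrightarrow> diagonal_matrix T \<and> (\<forall>i. T $ i $ i \<in> {1, - 1})"

definition signed_permutations_of :: "real^'r^'r \<Rightarrow> (real^'r^'r) set" where
  "signed_permutations_of Q =
    {Q ** P ** T | P T. permutation_matrix P \<and> sign_matrix T \<and> det (P ** T) = 1}"

definition estimated_diagonals :: "real^'r^'r^'k \<Rightarrow> real^'r^'r \<Rightarrow> real^'r^'r^'k" where
  "estimated_diagonals C Q = (\<chi> k. diag_part (matrix_inv Q ** C $ k ** Q))"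

definition H_matrix :: "real^'r^'r \<Rightarrow> real^('k::finite \<times> 'r \<times> 'r)^('k \<times> 'r \<times> 'r)" where
  "H_matrix Q = ((mat 1 :: real^'k^'k) \<otimes>\<^sub>K selection_matrix)
    ** ((mat 1 :: real^'k^'k) \<otimes>\<^sub>K transpose Q \<otimes>\<^sub>K matrix_inv Q)"


section \<open>Stochastic order symbols\<close>

text \<open>
  Every sample size \<open>n\<close> has its own probability space \<^term>\<open>M n\<close>. Measurability is part of the
  definitions, because \<^const>\<open>measure\<close> is \<open>0\<close> on non-measurable sets.
\<close>

definition tendsto_in_probability ::
    "(nat \<Rightarrow> 'w measure) \<Rightarrow> (nat \<Rightarrow> 'w \<Rightarrow> 'a::real_normed_vector) \<Rightarrow> 'a \<Rightarrow> bool" where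
  "tendsto_in_probability M X x \<longleftrightarrow>
    (\<forall>n. X n \<in> borel_measurable (M n)) \<and>
    (\<forall>\<epsilon>>0. (\<lambda>n. measure (M n) {\<omega> \<in> space (M n). norm (X n \<omega> - x) > \<epsilon>}) \<longlonglongrightarrow> 0)"

definition big_O_p ::
    "(nat \<Rightarrow> 'w measure) \<Rightarrow> (nat \<Rightarrow> 'w \<Rightarrow> 'a::real_normed_vector) \<Rightarrow> (nat \<Rightarrow> real) \<Rightarrow> bool" where
  "big_O_p M X a \<longleftrightarrow>
    (\<forall>n. X n \<in> borel_measurable (M n)) \<and>
    (\<forall>\<epsilon>>0. \<exists>K. \<forall>\<^sub>F n in sequentially.
      measure (M n) {\<omega> \<in> space (M n). norm (X n \<omega>) > K * \<bar>a n\<bar>} < \<epsilon>)"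

definition small_o_p ::
    "(nat \<Rightarrow> 'w measure) \<Rightarrow> (nat \<Rightarrow> 'w \<Rightarrow> 'a::real_normed_vector) \<Rightarrow> (nat \<Rightarrow> real) \<Rightarrow> bool" where
  "small_o_p M X a \<longleftrightarrow>
    (\<forall>n. X n \<in> borel_measurable (M n)) \<and>
    (\<forall>\<epsilon>>0. (\<lambda>n. measure (M n) {\<omega> \<in> space (M n). norm (X n \<omega>) > \<epsilon> * \<bar>a n\<bar>}) \<longlonglongrightarrow> 0)"

end

theory Submission
  imports Defs
begin

text \<open>
  Put \<open>A = Q0\<inverse> Qhat\<close> and \<open>Z = D A - A D\<close>. Then \<open>A\<inverse> D A - D = Z + (A\<inverse> - 1) Z\<close>, and \<open>Z\<close> has
  zero diagonal, so the diagonal of the left-hand side is of order \<open>|A - 1| |Z|\<close>. Comparing the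
  criterion at \<open>Qhat\<close> with its value at \<open>Q0\<close> gives \<open>|Z| = O(|Chat - C|)\<close> without any rate for \<open>Qhat\<close>.
  Hence the remainder of the linearization is at most a constant times \<open>|Qhat - Q0| |Chat - C|\<close>,
  and consistency of \<open>Qhat\<close> makes it \<open>o\<^sub>p(1/sqrt n)\<close>.
\<close>

section \<open>Frobenius norm, diagonal and off-diagonal parts\<close>

lemma norm_vec_power2:
  fixes x :: "'a::real_normed_vector^'n"
  shows "(norm x)\<^sup>2 = (\<Sum>i\<in>UNIV. (norm (x $ i))\<^sup>2)"
  by (simp add: norm_vec_def L2_set_def sum_nonneg)

text \<open>Cauchy-Schwarz bounds each entry by a row norm of \<open>A\<close> times a column norm
  of \<open>B\<close>, and the double sum of the squared bounds factors.\<close>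

lemma frobenius_submultiplicative:
  fixes A :: "real^'n^'m" and B :: "real^'p^'n"
  shows "norm (A ** B) \<le> norm A * norm B"
proof -
  have entry: "((A ** B) $ i $ j)\<^sup>2 \<le> (norm (A $ i))\<^sup>2 * (norm (transpose B $ j))\<^sup>2" for i j
  proof -
    have "(A ** B) $ i $ j = A $ i \<bullet> transpose B $ j"
      by (simp add: matrix_matrix_mult_def inner_vec_def transpose_def)
    then show ?thesis
      by (metis Cauchy_Schwarz_ineq power2_norm_eq_inner)
  qed
  have "(norm (A ** B))\<^sup>2 = (\<Sum>i\<in>UNIV. \<Sum>j\<in>UNIV. ((A ** B) $ i $ j)\<^sup>2)"
    by (simp add: norm_matrix_eq_frobenius sum_nonneg)
  also have "\<dots> \<le> (\<Sum>i\<in>UNIV. \<Sum>j\<in>UNIV. (norm (A $ i))\<^sup>2 * (norm (transpose B $ j))\<^sup>2)"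
    by (intro sum_mono entry)
  also have "\<dots> = (norm A)\<^sup>2 * (norm (transpose B))\<^sup>2"
    by (simp only: norm_vec_power2 sum_product)
  also have "norm (transpose B) = norm B"
    unfolding norm_matrix_eq_frobenius by (subst sum.swap) (simp add: transpose_def)
  finally show ?thesis
    by (simp flip: power_mult_distrib add: abs_le_square_iff)
qed

text \<open>Yields the distributive laws in \<open>matrix_mult_simps\<close> and, for measurability,
  continuity of the product.\<close>

lemma bounded_bilinear_matrix_mult:
  "bounded_bilinear ((**) :: real^'n^'m \<Rightarrow> real^'p^'n \<Rightarrow> real^'p^'m)"
proof
  show "\<exists>K. \<forall>(a :: real^'n^'m) (b :: real^'p^'n). norm (a ** b) \<le> norm a * norm b * K"
    by (intro exI[of _ 1]) (simp add: frobenius_submultiplicative)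
qed (simp_all add: matrix_matrix_mult_def vec_eq_iff sum.distrib sum_distrib_left algebra_simps)

lemmas matrix_mult_simps =
  bounded_bilinear.add_left[OF bounded_bilinear_matrix_mult]
  bounded_bilinear.add_right[OF bounded_bilinear_matrix_mult]
  bounded_bilinear.diff_left[OF bounded_bilinear_matrix_mult]
  bounded_bilinear.diff_right[OF bounded_bilinear_matrix_mult]

lemma norm_diag_part_le: "norm (diag_part A) \<le> norm A"
  unfolding norm_matrix_eq_frobenius
  by (intro real_sqrt_le_mono sum_mono) (simp add: diag_part_def)

lemma norm_off_part_le: "norm (off_part A) \<le> norm A"
  unfolding norm_matrix_eq_frobenius
  by (intro real_sqrt_le_mono sum_mono) (simp add: off_part_def diag_part_def)

lemma diag_part_add: "diag_part (A + B) = diag_part A + diag_part B"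
  by (simp add: diag_part_def vec_eq_iff)

lemma diag_part_diff: "diag_part (A - B) = diag_part A - diag_part B"
  by (simp add: diag_part_def vec_eq_iff)

lemma off_part_add: "off_part (A + B) = off_part A + off_part B"
  by (simp add: off_part_def diag_part_add)

lemma diag_part_diagonal: "diagonal_matrix A \<Longrightarrow> diag_part A = A"
  by (simp add: diag_part_def diagonal_matrix_def vec_eq_iff)

text \<open>Both products have \<open>D $ i $ i * A $ i $ i\<close> on the diagonal. Hence the
  commutator affects the diagonal only through the second-order term \<open>B ** Z\<close>
  below.\<close>

lemma diag_part_commutator:
  assumes "diagonal_matrix D"
  shows "diag_part (D ** A - A ** D) = 0"
proof -
  have "(\<Sum>k\<in>UNIV. D $ i $ k * A $ k $ i) = D $ i $ i * A $ i $ i"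
       "(\<Sum>k\<in>UNIV. A $ i $ k * D $ k $ i) = A $ i $ i * D $ i $ i" for i
    using assms by (auto simp: diagonal_matrix_def intro!: sum.remove[THEN trans, of _ i] sum.neutral)
  then show ?thesis
    by (simp add: diag_part_def matrix_matrix_mult_def vec_eq_iff)
qed

section \<open>Conjugation of a perturbed diagonal matrix\<close>

lemma norm_mat_1_ge_1: "1 \<le> norm (mat 1 :: real^'n^'n)"
proof -
  fix i :: 'n
  have "1 = norm ((mat 1 :: real^'n^'n) $ i $ i)" by (simp add: mat_def)
  also have "\<dots> \<le> norm ((mat 1 :: real^'n^'n) $ i)" by (rule Finite_Cartesian_Product.norm_nth_le)
  also have "\<dots> \<le> norm (mat 1 :: real^'n^'n)" by (rule Finite_Cartesian_Product.norm_nth_le)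
  finally show ?thesis .
qed

text \<open>The same \<open>f\<close> bounds the perturbation and the off-diagonal residual. The
  residual bound forces \<open>norm Z\<close> to be of order \<open>f\<close>, so each remainder
  term, \<open>B ** Z\<close>, \<open>B ** F ** A\<close> and \<open>F ** X\<close>, has one factor
  of order \<open>x\<close> and one of order \<open>f\<close>. The Frobenius norm of the identity is
  not 1 in general, so it is carried along as \<open>s\<close>.\<close>

lemma diag_part_conjugation_remainder:
  fixes A Ai D F :: "real^'r^'r"
  defines "s \<equiv> norm (mat 1 :: real^'r^'r)"
  assumes inv: "Ai ** A = mat 1" and D: "diagonal_matrix D"
    and x: "norm (A - mat 1) \<le> x" "x \<le> 1/4 / s"
    and F: "norm F \<le> f" and off: "norm (off_part (Ai ** (D + F) ** A)) \<le> f"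
  shows "norm (diag_part (Ai ** (D + F) ** A) - D - diag_part F) \<le> 25 * s ^ 3 * x * f"
proof -
  define X B Z where "X = A - mat 1" and "B = Ai - mat 1" and "Z = D ** A - A ** D"
  have s: "s \<ge> 1" unfolding s_def by (rule norm_mat_1_ge_1)
  have X: "norm X \<le> x" using x by (simp add: X_def)
  have x0: "0 \<le> x" using X norm_ge_zero order_trans by blast
  have f0: "0 \<le> f" using F norm_ge_zero order_trans by blast
  have xs: "x * s \<le> 1/4" using x(2) s by (simp add: field_simps)
  have x4: "x \<le> 1/4" using xs s x0 mult_left_mono[of 1 s x] by simp
  have A: "A = mat 1 + X" and Ai: "Ai = mat 1 + B" by (simp_all add: X_def B_def)
  \<comment> \<open>This bounds \<open>B\<close> by \<open>Ai\<close> itself. As \<open>x\<close> is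
    at most 1/4, \<open>norm Ai\<close> is at most \<open>s + norm Ai / 4\<close>, which can be
    solved for \<open>norm Ai\<close>.\<close>
  have "B = - (Ai ** X)"
    using inv by (simp add: B_def X_def matrix_mult_simps)
  then have B1: "norm B \<le> norm Ai * x"
    using frobenius_submultiplicative[of Ai X] X
    by (metis mult_left_mono norm_ge_zero norm_minus_cancel order_trans)
  have "norm Ai \<le> s + norm B"
    unfolding Ai s_def by (rule norm_triangle_ineq)
  moreover have "norm Ai * x \<le> norm Ai * (1/4)" by (intro mult_left_mono x4) simp
  ultimately have nAi: "norm Ai \<le> 2 * s" using B1 s by linarith
  have nB: "norm B \<le> 2 * s * x"
    using B1 mult_right_mono[OF nAi x0] by linarith
  have nA: "norm A \<le> 2 * s"
    using norm_triangle_ineq[of "mat 1" X] X x4 s by (simp add: A s_def)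
  have dZ: "diag_part Z = 0" unfolding Z_def by (rule diag_part_commutator[OF D])
  have eq: "Ai ** (D + F) ** A = D + (Z + B ** Z) + Ai ** F ** A"
  proof -
    \<comment> \<open>Multiplying the commutator by \<open>Ai\<close> turns \<open>A ** D\<close>
      into \<open>D\<close>; splitting \<open>Ai\<close> as \<open>mat 1 + B\<close> separates
      \<open>Z\<close> from a smaller term.\<close>
    have "Z + B ** Z = Ai ** Z" by (simp add: Ai matrix_mult_simps)
    also have "\<dots> = Ai ** D ** A - D"
      by (simp add: Z_def matrix_mult_simps matrix_mul_assoc inv)
    finally show ?thesis by (simp add: matrix_mult_simps)
  qed
  have nFA: "norm (Ai ** F ** A) \<le> 4 * s\<^sup>2 * f"
  proof -
    have "norm (Ai ** F ** A) \<le> (2 * s * f) * (2 * s)"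
      by (intro order_trans[OF frobenius_submultiplicative] mult_mono nAi F nA) (use s f0 in auto)
    then show ?thesis by (simp add: power2_eq_square mult_ac)
  qed
  have oD: "off_part D = 0" by (simp add: off_part_def diag_part_diagonal[OF D])
  \<comment> \<open>\<open>Z\<close> is its own off-diagonal part and \<open>D\<close> has none, so
    the off-diagonal part of \<open>eq\<close> can be solved for \<open>Z\<close>.\<close>
  have "Z = off_part (Ai ** (D + F) ** A) - off_part (B ** Z) - off_part (Ai ** F ** A)"
    using dZ oD by (simp add: eq off_part_add) (simp add: off_part_def)
  then have "norm Z = norm (off_part (Ai ** (D + F) ** A) - off_part (B ** Z)
      - off_part (Ai ** F ** A))"
    by (rule arg_cong)
  also have "\<dots> \<le> norm (off_part (Ai ** (D + F) ** A)) + norm (off_part (B ** Z))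
      + norm (off_part (Ai ** F ** A))"
    by (rule order_trans[OF norm_triangle_ineq4 add_right_mono[OF norm_triangle_ineq4]])
  also have "\<dots> \<le> f + norm B * norm Z + 4 * s\<^sup>2 * f"
    using off norm_off_part_le[of "B ** Z"] norm_off_part_le[of "Ai ** F ** A"]
      frobenius_submultiplicative[of B Z] nFA by linarith
  \<comment> \<open>The bound \<open>x * s \<le> 1/4\<close> gives \<open>norm B \<le> 1/2\<close>,
    so this term is absorbed into the left-hand side.\<close>
  also have "norm B * norm Z \<le> 1/2 * norm Z"
    using nB xs by (intro mult_right_mono) (auto simp: mult_ac)
  finally have "norm Z \<le> 2 * f + 8 * s\<^sup>2 * f" by simp
  also have "\<dots> \<le> 10 * s\<^sup>2 * f"
    using mult_right_mono[OF one_le_power[OF s, of 2] f0] by (simp add: mult_ac)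
  finally have nZ: "norm Z \<le> 10 * s\<^sup>2 * f" .
  have "Ai ** F ** A - F = B ** F ** A + F ** X"
    by (simp add: Ai A matrix_mult_simps)
  then have "diag_part (Ai ** (D + F) ** A) - D - diag_part F
      = diag_part (B ** Z + B ** F ** A + F ** X)"
    using dZ diag_part_diagonal[OF D]
    by (simp add: eq diag_part_add diag_part_diff algebra_simps)
  also have "norm \<dots> \<le> norm (B ** Z) + norm (B ** F ** A) + norm (F ** X)"
    by (intro order_trans[OF norm_diag_part_le] norm_triangle_le add_mono) auto
  also have "\<dots> \<le> (2 * s * x) * (10 * s\<^sup>2 * f) + (2 * s * x) * f * (2 * s) + f * x"
    by (intro add_mono order_trans[OF frobenius_submultiplicative] mult_mono nB nZ nA F X)
      (use s f0 x0 in auto)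
  also have "\<dots> = (20 * s ^ 3 + 4 * s\<^sup>2 + 1) * (x * f)"
    by (simp add: algebra_simps power2_eq_square power3_eq_cube)
  \<comment> \<open>The constant is 20 + 4 + 1, with lower powers of \<open>s\<close> raised to the
    third because \<open>s \<ge> 1\<close>.\<close>
  also have "\<dots> \<le> (25 * s ^ 3) * (x * f)"
    using power_increasing[OF _ s, of 2 3] one_le_power[OF s, of 3] x0 f0
    by (intro mult_right_mono) auto
  finally show ?thesis by (simp add: mult.assoc)
qed

section \<open>Matrix inverses, vectorization and \<open>H_matrix\<close>\<close>

lemma matrix_inv_left: "invertible A \<Longrightarrow> matrix_inv A ** A = mat 1"
  and matrix_inv_right: "invertible A \<Longrightarrow> A ** matrix_inv A = mat 1"
  unfolding matrix_inv_def invertible_def by (metis (mono_tags, lifting) someI_ex)+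

lemma norm_vec_tuple: "norm (vec_tuple C) = norm C"
proof -
  have "norm (vec_tuple C) = sqrt (\<Sum>(k, j, i)\<in>UNIV. (C $ k $ i $ j)\<^sup>2)"
    by (simp add: norm_vec_def L2_set_def vec_tuple_def vec_cols_def case_prod_unfold)
  also have "\<dots> = sqrt (\<Sum>k\<in>UNIV. \<Sum>j\<in>UNIV. \<Sum>i\<in>UNIV. (C $ k $ i $ j)\<^sup>2)"
    by (simp add: sum.cartesian_product case_prod_unfold)
  also have "\<dots> = norm C"
    unfolding norm_tuple_eq_frobenius by (intro arg_cong[where f=sqrt] sum.cong refl sum.swap)
  finally show ?thesis .
qed

text \<open>The Kronecker product is block diagonal here: in the sum over block indices only
  \<open>l = k\<close> contributes.\<close>

lemma mat_1_kronecker_vec_tuple: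
  fixes B :: "real^('n::finite \<times> 'm::finite)^('p::finite \<times> 'q::finite)"
    and C :: "real^'n^'m^'k"
  shows "((mat 1 :: real^'k^'k) \<otimes>\<^sub>K B) *v vec_tuple C = (\<chi> p. (B *v vec_cols (C $ fst p)) $ snd p)"
proof -
  have "(\<Sum>q\<in>UNIV. (if k = fst q then 1 else 0) * B $ p $ snd q * vec_cols (C $ fst q) $ snd q)
      = (\<Sum>l\<in>UNIV. \<Sum>q\<in>UNIV. if k = l then B $ p $ q * vec_cols (C $ l) $ q else 0)" for k p
    unfolding sum.cartesian_product by (intro sum.cong) (auto)
  also have "\<dots> k p = (\<Sum>q\<in>UNIV. B $ p $ q * vec_cols (C $ k) $ q)" for k p
    by (subst sum.swap) (simp)
  finally show ?thesis
    by (simp add: vec_eq_iff kronecker_def matrix_vector_mult_def vec_tuple_def mat_def)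
qed

text \<open>By \<open>kronecker_vec_cols\<close> the right factor conjugates each block, and the
  left factor then selects diagonals. This identifies the linear term of the expansion.\<close>

lemma H_matrix_vec_tuple:
  fixes C :: "real^'r^'r^'k"
  shows "H_matrix Q *v vec_tuple C = vec_tuple (\<chi> k. diag_part (matrix_inv Q ** C $ k ** Q))"
proof -
  have "((mat 1 :: real^'k^'k) \<otimes>\<^sub>K transpose Q \<otimes>\<^sub>K matrix_inv Q) *v vec_tuple C
      = vec_tuple (\<chi> k. matrix_inv Q ** C $ k ** Q)"
    by (simp add: mat_1_kronecker_vec_tuple kronecker_vec_cols) (simp add: vec_tuple_def)
  then show ?thesis
    unfolding H_matrix_def
    by (simp add: mat_1_kronecker_vec_tuple selection_matrix_vec_cols flip: matrix_vector_mul_assoc)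
      (simp add: vec_tuple_def)
qed

section \<open>Deterministic linearization at a minimizer\<close>

lemma invertible_minimizer: "is_minimizer m C Q \<Longrightarrow> invertible Q"
  by (simp add: is_minimizer_def is_arg_min_def feasible_def invertible_det_nz)

text \<open>One block is dominated by the whole criterion, and the minimum by the value at
  \<open>Q0\<close>. There the true matrices become diagonal, so only \<open>Ch - C\<close>
  contributes.\<close>

lemma norm_off_part_minimizer_le:
  fixes Q Q0 :: "real^'r^'r" and Ch C D :: "real^'r^'r^'k"
  assumes min: "is_minimizer m Ch Q" and feas: "Q0 \<in> feasible m"
    and Q0: "invertible Q0" and D: "\<And>k. diagonal_matrix (D $ k)"
    and C: "\<And>k. C $ k = Q0 ** D $ k ** matrix_inv Q0"
  shows "norm (off_part (matrix_inv Q ** Ch $ k ** Q))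
    \<le> norm (matrix_inv Q0) * norm Q0 * norm (Ch - C)"
proof -
  let ?c = "norm (matrix_inv Q0) * norm Q0"
  have *: "norm (off_part (matrix_inv Q0 ** Ch $ l ** Q0)) \<le> ?c * norm ((Ch - C) $ l)" for l
  proof -
    have "matrix_inv Q0 ** C $ l ** Q0 = (matrix_inv Q0 ** Q0) ** D $ l ** (matrix_inv Q0 ** Q0)"
      by (simp only: C matrix_mul_assoc)
    then have "matrix_inv Q0 ** Ch $ l ** Q0 = D $ l + matrix_inv Q0 ** (Ch - C) $ l ** Q0"
      by (simp add: matrix_mult_simps matrix_inv_left[OF Q0])
    then have "off_part (matrix_inv Q0 ** Ch $ l ** Q0) = off_part (matrix_inv Q0 ** (Ch - C) $ l ** Q0)"
      using diag_part_diagonal[OF D[of l]] by (simp add: off_part_add) (simp add: off_part_def)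
    then have "norm (off_part (matrix_inv Q0 ** Ch $ l ** Q0)) \<le> norm (matrix_inv Q0 ** (Ch - C) $ l ** Q0)"
      by (metis norm_off_part_le)
    also have "\<dots> \<le> norm (matrix_inv Q0) * norm ((Ch - C) $ l) * norm Q0"
      by (intro order_trans[OF frobenius_submultiplicative] mult_right_mono
          frobenius_submultiplicative) simp
    finally show ?thesis by (simp add: mult_ac)
  qed
  have "(norm (off_part (matrix_inv Q ** Ch $ k ** Q)))\<^sup>2 \<le> off_criterion Ch Q"
    unfolding off_criterion_def by (rule member_le_sum) auto
  also have "\<dots> \<le> off_criterion Ch Q0"
    using min feas by (auto simp: is_minimizer_def is_arg_min_linorder)
  also have "\<dots> \<le> (\<Sum>l\<in>UNIV. (?c * norm ((Ch - C) $ l))\<^sup>2)"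
    unfolding off_criterion_def by (intro sum_mono power_mono *) simp
  also have "\<dots> = (?c * norm (Ch - C))\<^sup>2"
    by (simp add: power_mult_distrib norm_vec_power2 sum_distrib_left)
  finally show ?thesis
    by (rule power2_le_imp_le) simp
qed

text \<open>Passing to the coordinates of \<open>Q0\<close> reduces each block to the conjugation
  bound. The constants are fixed before \<open>Ch\<close> and \<open>Q\<close>, so the bound can be
  applied at every sample point.\<close>

lemma estimated_diagonals_linearization:
  fixes Q0 :: "real^'r^'r" and C D :: "real^'r^'r^'k"
  assumes Q0: "invertible Q0" and feas: "Q0 \<in> feasible m"
    and D: "\<And>k. diagonal_matrix (D $ k)"
    and C: "\<And>k. C $ k = Q0 ** D $ k ** matrix_inv Q0"
  obtains \<eta> K where "\<eta> > 0" "K \<ge> 0"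
    "\<And>Ch Q. is_minimizer m Ch Q \<Longrightarrow> norm (Q - Q0) \<le> \<eta> \<Longrightarrow>
      norm (estimated_diagonals Ch Q - D - (\<chi> k. diag_part (matrix_inv Q0 ** (Ch - C) $ k ** Q0)))
      \<le> K * norm (Q - Q0) * norm (Ch - C)"
proof
  define s q c where "s = norm (mat 1 :: real^'r^'r)" and "q = norm (matrix_inv Q0)"
    and "c = q * norm Q0"
  define L where "L = 25 * s ^ 3 * q * c"
  have s: "s \<ge> 1" unfolding s_def by (rule norm_mat_1_ge_1)
  have q: "q \<ge> 0" by (simp add: q_def)
  \<comment> \<open>This radius makes \<open>q * norm (Q - Q0)\<close> at most
    \<open>1/4 / s\<close>; adding 1 to \<open>q\<close> keeps the denominator positive.\<close>
  show "1/4 / s / (q + 1) > 0" using s q by simp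
  \<comment> \<open>The factor \<open>CARD('k)\<close> comes from bounding the norm of a tuple by
    the sum of its block norms.\<close>
  show "real CARD('k) * L \<ge> 0" using s q by (simp add: c_def L_def)
  fix Ch :: "real^'r^'r^'k" and Q :: "real^'r^'r"
  assume min: "is_minimizer m Ch Q" and close: "norm (Q - Q0) \<le> 1/4 / s / (q + 1)"
  let ?R = "estimated_diagonals Ch Q - D - (\<chi> k. diag_part (matrix_inv Q0 ** (Ch - C) $ k ** Q0))"
  let ?f = "c * norm (Ch - C)"
  have Q: "invertible Q" by (rule invertible_minimizer[OF min])
  have "norm (?R $ k) \<le> L * norm (Q - Q0) * norm (Ch - C)" for k
  proof -
    define A Ai F where "A = matrix_inv Q0 ** Q" and "Ai = matrix_inv Q ** Q0"
      and "F = matrix_inv Q0 ** (Ch - C) $ k ** Q0"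
    have inv: "Ai ** A = mat 1"
    proof -
      have "Ai ** A = matrix_inv Q ** (Q0 ** matrix_inv Q0) ** Q"
        by (simp only: A_def Ai_def matrix_mul_assoc)
      then show ?thesis by (simp add: matrix_inv_right[OF Q0] matrix_inv_left[OF Q])
    qed
    have "A - mat 1 = matrix_inv Q0 ** (Q - Q0)"
      by (simp add: A_def matrix_mult_simps matrix_inv_left[OF Q0])
    then have x: "norm (A - mat 1) \<le> q * norm (Q - Q0)"
      unfolding q_def by (simp add: frobenius_submultiplicative)
    have "(q + 1) * norm (Q - Q0) \<le> 1/4 / s"
      using mult_left_mono[OF close, of "q + 1"] q by simp
    then have x': "q * norm (Q - Q0) \<le> 1/4 / s"
      using norm_ge_zero[of "Q - Q0"] unfolding distrib_right by linarith
    have F: "norm F \<le> ?f"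
    proof -
      have "norm F \<le> (q * norm ((Ch - C) $ k)) * norm Q0"
        unfolding F_def q_def
        by (intro order_trans[OF frobenius_submultiplicative] mult_right_mono
            frobenius_submultiplicative) simp
      also have "\<dots> \<le> (q * norm (Ch - C)) * norm Q0"
        using q by (intro mult_right_mono mult_left_mono Finite_Cartesian_Product.norm_nth_le) auto
      finally show ?thesis by (simp add: c_def mult_ac)
    qed
    \<comment> \<open>In the coordinates of \<open>Q0\<close>, \<open>Ch $ k\<close> is
      \<open>D $ k + F\<close>, so conjugating that by \<open>A\<close> gives the matrix in the
      criterion and the estimator.\<close>
    have conj: "Ai ** (D $ k + F) ** A = matrix_inv Q ** Ch $ k ** Q"
    proof -
      have "Q0 ** F ** matrix_inv Q0
          = (Q0 ** matrix_inv Q0) ** (Ch - C) $ k ** (Q0 ** matrix_inv Q0)"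
        by (simp only: F_def matrix_mul_assoc)
      then have "Q0 ** (D $ k + F) ** matrix_inv Q0 = Ch $ k"
        by (simp add: matrix_mult_simps matrix_inv_right[OF Q0] C[symmetric])
      moreover have "Ai ** (D $ k + F) ** A = matrix_inv Q ** (Q0 ** (D $ k + F) ** matrix_inv Q0) ** Q"
        by (simp only: A_def Ai_def matrix_mul_assoc)
      ultimately show ?thesis by simp
    qed
    have "norm (off_part (Ai ** (D $ k + F) ** A)) \<le> ?f"
      unfolding conj c_def q_def by (rule norm_off_part_minimizer_le[OF min feas Q0 D C])
    from diag_part_conjugation_remainder[OF inv D x x'[unfolded s_def] F this]
    have "norm (diag_part (Ai ** (D $ k + F) ** A) - D $ k - diag_part F)
      \<le> L * norm (Q - Q0) * norm (Ch - C)"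
      by (simp add: L_def s_def mult_ac)
    then show ?thesis unfolding conj by (simp add: F_def estimated_diagonals_def)
  qed
  then have "(\<Sum>k\<in>UNIV. norm (?R $ k)) \<le> real CARD('k) * (L * norm (Q - Q0) * norm (Ch - C))"
    by (intro sum_bounded_above)
  moreover have "norm ?R \<le> (\<Sum>k\<in>UNIV. norm (?R $ k))"
    unfolding norm_vec_def by (rule L2_set_le_sum) simp
  ultimately show "norm ?R \<le> real CARD('k) * L * norm (Q - Q0) * norm (Ch - C)"
    by (simp add: mult.assoc)
qed

section \<open>Stochastic order of a product\<close>

text \<open>Near \<open>q\<close> the bound is a factor tending to 0 in probability times one
  bounded in probability; consistency makes the event outside the radius \<open>\<eta>\<close>
  asymptotically negligible.\<close>

lemma small_o_p_product_bound:
  fixes Q :: "nat \<Rightarrow> 'w \<Rightarrow> 'a::euclidean_space" and E :: "nat \<Rightarrow> 'w \<Rightarrow> real"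
    and R :: "nat \<Rightarrow> 'w \<Rightarrow> 'b::real_normed_vector"
  assumes M: "\<And>n. prob_space (M n)" and Q: "tendsto_in_probability M Q q"
    and E: "big_O_p M E (\<lambda>n. 1 / sqrt (real n))"
    and R: "\<And>n. R n \<in> borel_measurable (M n)"
    and "\<eta> > 0" "K \<ge> 0"
    and bound: "\<And>n \<omega>. \<omega> \<in> space (M n) \<Longrightarrow> norm (Q n \<omega> - q) \<le> \<eta> \<Longrightarrow>
      norm (R n \<omega>) \<le> K * norm (Q n \<omega> - q) * (sqrt (real n) * \<bar>E n \<omega>\<bar>)"
  shows "small_o_p M R (\<lambda>n. 1)"
  unfolding small_o_p_def
proof (intro conjI allI impI R)
  fix \<epsilon> :: real assume \<epsilon>: "\<epsilon> > 0"
  have Qm[measurable]: "Q n \<in> borel_measurable (M n)" for n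
    using Q by (simp add: tendsto_in_probability_def)
  have Em[measurable]: "E n \<in> borel_measurable (M n)" for n
    using E by (simp add: big_O_p_def)
  show "(\<lambda>n. measure (M n) {\<omega> \<in> space (M n). norm (R n \<omega>) > \<epsilon> * \<bar>1\<bar>}) \<longlonglongrightarrow> 0"
  proof (rule tendstoI)
    fix \<delta> :: real assume \<delta>: "\<delta> > 0"
    obtain L where L: "\<forall>\<^sub>F n in sequentially.
        measure (M n) {\<omega> \<in> space (M n). norm (E n \<omega>) > L * \<bar>1 / sqrt (real n)\<bar>} < \<delta> / 2"
      using conjunct2[OF E[unfolded big_O_p_def], rule_format, OF half_gt_zero[OF \<delta>]] by blast
    \<comment> \<open>Chosen so that \<open>bound\<close> applies and
      \<open>K * \<rho> * abs L\<close> is at most \<open>\<epsilon>\<close>. The added ones keep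
      the denominator positive; the absolute value covers a negative \<open>L\<close>.\<close>
    define \<rho> where "\<rho> = min \<eta> (\<epsilon> / ((K + 1) * (\<bar>L\<bar> + 1)))"
    have \<rho>: "\<rho> > 0" using \<epsilon> \<open>\<eta> > 0\<close> \<open>K \<ge> 0\<close> by (simp add: \<rho>_def add_nonneg_pos)
    have "\<rho> * ((K + 1) * (\<bar>L\<bar> + 1)) \<le> \<epsilon>"
      using \<open>K \<ge> 0\<close> by (simp add: \<rho>_def add_nonneg_pos flip: pos_le_divide_eq)
    moreover have "K * \<rho> * \<bar>L\<bar> \<le> \<rho> * ((K + 1) * (\<bar>L\<bar> + 1))"
      using \<rho> \<open>K \<ge> 0\<close> by (simp add: algebra_simps)
    ultimately have small: "K * \<rho> * \<bar>L\<bar> \<le> \<epsilon>" by linarith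
    have "(\<lambda>n. measure (M n) {\<omega> \<in> space (M n). norm (Q n \<omega> - q) > \<rho>}) \<longlonglongrightarrow> 0"
      using Q \<rho> by (simp add: tendsto_in_probability_def)
    then have "\<forall>\<^sub>F n in sequentially. measure (M n) {\<omega> \<in> space (M n). norm (Q n \<omega> - q) > \<rho>} < \<delta> / 2"
      using \<delta> by (intro order_tendstoD) auto
    with L show "\<forall>\<^sub>F n in sequentially.
      dist (measure (M n) {\<omega> \<in> space (M n). norm (R n \<omega>) > \<epsilon> * \<bar>1\<bar>}) 0 < \<delta>"
      \<comment> \<open>Positive \<open>n\<close> lets \<open>1 / sqrt (real n)\<close> be cleared;
        at \<open>n = 0\<close> it has the default value 0.\<close>
      using eventually_gt_at_top[of 0]
    proof eventually_elim
      case (elim n)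
      interpret prob_space "M n" by (rule M)
      let ?A = "{\<omega> \<in> space (M n). norm (E n \<omega>) > L * \<bar>1 / sqrt (real n)\<bar>}"
      let ?B = "{\<omega> \<in> space (M n). norm (Q n \<omega> - q) > \<rho>}"
      \<comment> \<open>Outside \<open>?A\<close> and \<open>?B\<close> both factors are controlled,
        so the remainder cannot exceed \<open>\<epsilon>\<close>.\<close>
      have "{\<omega> \<in> space (M n). norm (R n \<omega>) > \<epsilon> * \<bar>1\<bar>} \<subseteq> ?A \<union> ?B"
      proof (rule ccontr)
        assume "\<not> ?thesis"
        then obtain \<omega> where \<omega>: "\<omega> \<in> space (M n)" "norm (R n \<omega>) > \<epsilon>"
          "norm (E n \<omega>) \<le> L * \<bar>1 / sqrt (real n)\<bar>" "norm (Q n \<omega> - q) \<le> \<rho>" by force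
        have "sqrt (real n) * \<bar>E n \<omega>\<bar> \<le> L"
          using \<omega>(3) elim(3) by (simp add: field_simps)
        then have *: "sqrt (real n) * \<bar>E n \<omega>\<bar> \<le> \<bar>L\<bar>" by linarith
        have "norm (R n \<omega>) \<le> K * norm (Q n \<omega> - q) * (sqrt (real n) * \<bar>E n \<omega>\<bar>)"
          using \<omega> by (intro bound) (auto simp: \<rho>_def)
        also have "\<dots> \<le> K * \<rho> * \<bar>L\<bar>"
          using \<rho> \<open>K \<ge> 0\<close> \<omega>(4) * by (intro mult_mono) auto
        finally show False using small \<omega>(2) by linarith
      qed
      then have "prob {\<omega> \<in> space (M n). norm (R n \<omega>) > \<epsilon> * \<bar>1\<bar>} \<le> prob (?A \<union> ?B)"
        by (rule finite_measure_mono) measurable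
      also have "\<dots> \<le> prob ?A + prob ?B"
        by (rule measure_Un_le) measurable
      finally show ?case using elim by simp
    qed
  qed
qed

section \<open>Measurability of the estimated diagonals\<close>

text \<open>
  Unlike \<^const>\<open>matrix_inv\<close>, which is defined by a choice operator, this is continuous everywhere;
  the two agree when the determinant is \<open>1\<close>.
\<close>

definition cramer_inverse :: "real^'r^'r \<Rightarrow> real^'r^'r" where
  "cramer_inverse A = (\<chi> i j. det (\<chi> k l. if l = i then (axis j 1 :: real^'r) $ k else A $ k $ l))"

text \<open>Column \<open>j\<close> of the inverse solves \<open>A *v x = axis j 1\<close>, and the
  denominator in Cramer's rule is \<open>det A = 1\<close>.\<close>

lemma matrix_inv_eq_cramer_inverse:
  assumes "det A = 1"
  shows "matrix_inv A = cramer_inverse A"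
proof -
  have A: "A ** matrix_inv A = mat 1"
    using assms by (simp add: matrix_inv_right invertible_det_nz)
  have "matrix_inv A $ i $ j = cramer_inverse A $ i $ j" for i j
  proof -
    have "A *v column j (matrix_inv A) = axis j 1"
    proof -
      have "A *v column j (matrix_inv A) = column j (A ** matrix_inv A)"
        by (simp add: column_def matrix_vector_mult_def matrix_matrix_mult_def vec_eq_iff)
      then show ?thesis unfolding A by (simp add: column_def mat_def axis_def vec_eq_iff)
    qed
    then have "column j (matrix_inv A)
        = (\<chi> i. det (\<chi> k l. if l = i then (axis j 1 :: real^'a) $ k else A $ k $ l) / det A)"
      using assms by (subst (asm) cramer) auto
    then show ?thesis
      using assms by (simp add: cramer_inverse_def column_def vec_eq_iff)
  qed
  then show ?thesis by (simp add: vec_eq_iff)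
qed

lemma continuous_on_cramer_inverse [continuous_intros]:
  assumes "continuous_on S f"
  shows "continuous_on S (\<lambda>x. cramer_inverse (f x))"
proof -
  have *: "continuous_on S (\<lambda>x. if l = i then c else f x $ k $ l)" for i k l c
    using assms by (cases "l = i") (auto intro!: continuous_intros)
  show ?thesis
    unfolding cramer_inverse_def det_def by (intro continuous_intros) (simp add: *)
qed

text \<open>With \<open>cramer_inverse\<close> in place of \<open>matrix_inv\<close>, the estimator
  is a continuous function of the pair of matrices, hence Borel; the determinant condition makes the
  two versions agree on \<open>space M\<close>.\<close>

lemma borel_measurable_estimated_diagonals:
  fixes C :: "'w \<Rightarrow> real^'r^'r^'k" and Q :: "'w \<Rightarrow> real^'r^'r"
  assumes "C \<in> borel_measurable M" "Q \<in> borel_measurable M"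
    and "\<And>\<omega>. \<omega> \<in> space M \<Longrightarrow> det (Q \<omega>) = 1"
  shows "(\<lambda>\<omega>. estimated_diagonals (C \<omega>) (Q \<omega>)) \<in> borel_measurable M"
proof -
  let ?g = "\<lambda>(C :: real^'r^'r^'k, Q). (\<chi> k. diag_part (cramer_inverse Q ** C $ k ** Q))"
  have diag: "continuous_on S (\<lambda>x. diag_part (f x))" if "continuous_on S f"
    for f :: "(real^'r^'r^'k) \<times> (real^'r^'r) \<Rightarrow> real^'r^'r" and S
  proof -
    have "continuous_on S (\<lambda>x. if i = j then f x $ i $ j else 0)" for i j
      using that by (cases "i = j") (auto intro!: continuous_intros)
    then show ?thesis unfolding diag_part_def by (intro continuous_intros)
  qed
  have "continuous_on UNIV ?g"
    unfolding case_prod_unfold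
    by (intro continuous_intros diag bounded_bilinear.continuous_on[OF bounded_bilinear_matrix_mult])
  then have g: "?g \<in> borel_measurable borel"
    by (rule borel_measurable_continuous_onI)
  have "(\<lambda>\<omega>. (C \<omega>, Q \<omega>)) \<in> borel_measurable M"
    by (rule borel_measurable_Pair[OF assms(1,2)])
  from measurable_compose[OF this g]
  have "(\<lambda>\<omega>. \<chi> k. diag_part (cramer_inverse (Q \<omega>) ** C \<omega> $ k ** Q \<omega>)) \<in> borel_measurable M"
    unfolding case_prod_conv .
  moreover have "estimated_diagonals (C \<omega>) (Q \<omega>) = (\<chi> k. diag_part (cramer_inverse (Q \<omega>) ** C \<omega> $ k ** Q \<omega>))"
    if "\<omega> \<in> space M" for \<omega>
    unfolding estimated_diagonals_def matrix_inv_eq_cramer_inverse[OF assms(3)[OF that]] ..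
  ultimately show ?thesis
    by (simp cong: measurable_cong)
qed

section \<open>Asymptotic linearity of the estimated diagonals\<close>

theorem theorem6:
  fixes M :: "nat \<Rightarrow> 'w measure"
    and m :: real
    and C D :: "real^'r^'r^'k"
    and Q0 Qstar :: "real^'r^'r"
    and Chat :: "nat \<Rightarrow> 'w \<Rightarrow> real^'r^'r^'k"
    and Qhat :: "nat \<Rightarrow> 'w \<Rightarrow> real^'r^'r"
  assumes "\<And>n. prob_space (M n)"
    and "m > 0"
    and "invertible Q0"
    and "\<And>k. diagonal_matrix (D $ k)"
    and "\<And>k. C $ k = Q0 ** D $ k ** matrix_inv Q0"
    and "\<exists>Q \<in> feasible m. \<forall>k. diagonal_matrix (matrix_inv Q ** C $ k ** Q)"
    and "is_minimizer m C Qstar"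
    and "{Q. is_minimizer m C Q} = signed_permutations_of Qstar"
    and "signed_permutations_of Qstar \<subseteq> top_of_set det_one_equal_norms interior_of feasible m"
    and "Q0 \<in> signed_permutations_of Qstar"
    and "\<And>n. Chat n \<in> borel_measurable (M n)"
    and "\<And>n. Qhat n \<in> borel_measurable (M n)"
    and "\<And>n \<omega>. \<omega> \<in> space (M n) \<Longrightarrow> is_minimizer m (Chat n \<omega>) (Qhat n \<omega>)"
    and "tendsto_in_probability M Qhat Q0"
    and "big_O_p M (\<lambda>n \<omega>. norm (Chat n \<omega> - C)) (\<lambda>n. 1 / sqrt (real n))"
  shows "small_o_p M
    (\<lambda>n \<omega>. sqrt (real n) *\<^sub>R vec_tuple (estimated_diagonals (Chat n \<omega>) (Qhat n \<omega>) - D)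
          - H_matrix Q0 *v (sqrt (real n) *\<^sub>R vec_tuple (Chat n \<omega> - C)))
    (\<lambda>n. 1)"
proof -
  let ?E = "\<lambda>n \<omega>. Chat n \<omega> - C"
  let ?R = "\<lambda>n \<omega>. estimated_diagonals (Chat n \<omega>) (Qhat n \<omega>) - D
    - (\<chi> k. diag_part (matrix_inv Q0 ** ?E n \<omega> $ k ** Q0))"
  let ?T = "\<lambda>n \<omega>. sqrt (real n) *\<^sub>R vec_tuple (estimated_diagonals (Chat n \<omega>) (Qhat n \<omega>) - D)
    - H_matrix Q0 *v (sqrt (real n) *\<^sub>R vec_tuple (?E n \<omega>))"
  have vec_diff: "vec_tuple (A - B) = vec_tuple A - vec_tuple B" for A B :: "real^'r^'r^'k"
    by (simp add: vec_tuple_def vec_cols_def vec_eq_iff)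
  \<comment> \<open>By linearity the whole expression is one scaled and stacked \<open>?R\<close>;
    stacking preserves norms, so the deterministic bound carries over.\<close>
  have T: "?T n \<omega> = sqrt (real n) *\<^sub>R vec_tuple (?R n \<omega>)" for n \<omega>
    unfolding matrix_vector_mult_scaleR vec_diff[symmetric] H_matrix_vec_tuple
      scaleR_diff_right[symmetric] ..
  have minimizer: "is_minimizer m (Chat n \<omega>) (Qhat n \<omega>)" if "\<omega> \<in> space (M n)" for n \<omega>
    using that by (rule assms(13))
  \<comment> \<open>\<open>Q0\<close> is a minimizer for the true \<open>C\<close>, hence feasible,
    and may therefore compete with \<open>Qhat\<close> in the perturbed problem.\<close>
  have feas: "Q0 \<in> feasible m"
    using assms(8,10) by (auto simp: is_minimizer_def is_arg_min_def)
  obtain \<eta> K where "\<eta> > 0" "K \<ge> 0" and K: "\<And>Ch Q. is_minimizer m Ch Q \<Longrightarrow> norm (Q - Q0) \<le> \<eta> \<Longrightarrow>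
      norm (estimated_diagonals Ch Q - D - (\<chi> k. diag_part (matrix_inv Q0 ** (Ch - C) $ k ** Q0)))
      \<le> K * norm (Q - Q0) * norm (Ch - C)"
    using estimated_diagonals_linearization[OF assms(3) feas assms(4,5)] by metis
  show ?thesis
  proof (rule small_o_p_product_bound[OF assms(1,14,15) _ \<open>\<eta> > 0\<close> \<open>K \<ge> 0\<close>])
    fix n
    have [measurable]: "Chat n \<in> borel_measurable (M n)" by (rule assms(11))
    \<comment> \<open>Minimizers are feasible, which supplies the determinant condition.\<close>
    have [measurable]: "(\<lambda>\<omega>. estimated_diagonals (Chat n \<omega>) (Qhat n \<omega>)) \<in> borel_measurable (M n)"
      using minimizer by (intro borel_measurable_estimated_diagonals assms(11,12))
        (auto simp: is_minimizer_def is_arg_min_def feasible_def)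
    have [measurable]: "vec_tuple \<in> borel_measurable (borel :: (real^'r^'r^'k) measure)"
      unfolding vec_tuple_def vec_cols_def
      by (intro borel_measurable_continuous_onI) (auto intro!: continuous_intros)
    have [measurable]: "(*v) (H_matrix Q0) \<in> borel_measurable (borel :: (real^('k \<times> 'r \<times> 'r)) measure)"
      by (intro borel_measurable_continuous_onI matrix_vector_mult_linear_continuous_on)
    show "?T n \<in> borel_measurable (M n)" by measurable
  next
    fix n \<omega> assume "\<omega> \<in> space (M n)" "norm (Qhat n \<omega> - Q0) \<le> \<eta>"
    then have "norm (?R n \<omega>) \<le> K * norm (Qhat n \<omega> - Q0) * norm (?E n \<omega>)"
      by (intro K minimizer)
    then have "sqrt (real n) * norm (?R n \<omega>)
        \<le> sqrt (real n) * (K * norm (Qhat n \<omega> - Q0) * norm (?E n \<omega>))"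
      by (intro mult_left_mono) auto
    then show "norm (?T n \<omega>)
        \<le> K * norm (Qhat n \<omega> - Q0) * (sqrt (real n) * \<bar>norm (?E n \<omega>)\<bar>)"
      unfolding T by (simp add: norm_vec_tuple mult_ac)
  qed
qed

end
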